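(* Let $\gamma,L>0$ and $\varepsilon\ge 0$. Suppose that: for every $w\in M$, $\phi(\cdot,\cdot,w)$ is continuously differentiable on $\mathbb{R}^n\times\mathbb{R}^m$, $\gamma$-strongly convex in $x$ for every $y\in\mathbb{R}^m$ and $\gamma$-strongly concave in $y$ for every $x\in\mathbb{R}^n$; the map $\psi(z,w)=(\nabla_x\phi(z,w),-\nabla_y\phi(z,w))$ satisfies $\|\psi(z,w)-\psi(z',w)\|\le L\|z-z'\|$ and $\|\psi(z,w)-\psi(z,w')\|\le L\,\mathrm{d}(w,w')$ for all $z,z'\in\mathbb{R}^n\times\mathbb{R}^m$ and $w,w'\in M$; $W_1(D(z),D(z'))\le\varepsilon\|z-z'\|$ for all $z,z'\in\mathbb{R}^n\times\mathbb{R}^m$; and opposing mixture dominance holds: for all $x,x',x_0\in\mathbb{R}^n$, $y,y',y_0\in\mathbb{R}^m$ and $\tau\in[0,1]$, $$\mathbb{E}_{w\sim D(\tau x+(1-\tau)x',y)}[\phi(x_0,y_0,w)]\le\mathbb{E}_{w\sim\tau D(x,y)+(1-\tau)D(x',y)}[\phi(x_0,y_0,w)],$$ $$\mathbb{E}_{w\sim\tau D(x,y)+(1-\tau)D(x,y')}[\phi(x_0,y_0,w)]\le\mathbb{E}_{w\sim D(x,\tau y+(1-\tau)y')}[\phi(x_0,y_0,w)].$$ Then $(x,y)\mapsto\Phi(x,y)=\mathbb{E}_{w\sim D(x,y)}[\phi(x,y,w)]$ is $(\gamma-2\varepsilon L)$-strongly-convex-strongly-concave over $\mathbb{R}^n\times\mathbb{R}^m$,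 i.e. $(\gamma-2\varepsilon L)$-strongly convex in $x$ for every $y$ and $(\gamma-2\varepsilon L)$-strongly concave in $y$ for every $x$.
   Context: $(M,\mathrm{d})$ is a complete separable metric space, $\mathcal{P}(M)$ is the set of Radon probability measures on $M$ with finite first moment, and $W_1$ is the Wasserstein-1 distance. $\phi:\mathbb{R}^n\times\mathbb{R}^m\times M\to\mathbb{R}$, and $D:\mathbb{R}^n\times\mathbb{R}^m\to\mathcal{P}(M)$ is the distributional map. Here $\tau D(x,y)+(1-\tau)D(x',y)$ denotes the mixture (convex combination) of the two measures. The paper assumes, without loss of generality, that $D(x,y)$ has a probability density (or mass) function $p(w;x,y)$, so that $\Phi(x,y)=\int_M\phi(x,y,w)p(w;x,y)\,dw$. Expectations are assumed well defined. A function $f$ is $\mu$-strongly convex if $f-\frac{\mu}{2}\|\cdot\|^2$ is convex, and $\mu$-strongly concave if $-f$ is $\mu$-strongly convex. *)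

theory Defs
  imports "HOL-Probability.Probability"
begin

text \<open>The modulus \<open>c\<close> is an arbitrary real number; it may be zero or negative.\<close>

definition strongly_convex :: "real \<Rightarrow> ('a::real_normed_vector \<Rightarrow> real) \<Rightarrow> bool" where
  "strongly_convex c f \<longleftrightarrow> convex_on UNIV (\<lambda>x. f x - c / 2 * (norm x)\<^sup>2)"

definition strongly_concave :: "real \<Rightarrow> ('a::real_normed_vector \<Rightarrow> real) \<Rightarrow> bool" where
  "strongly_concave c f \<longleftrightarrow> strongly_convex c (\<lambda>x. - f x)"

definition continuously_differentiable ::
    "('a::real_normed_vector \<Rightarrow> 'b::real_normed_vector) \<Rightarrow> bool" where
  "continuously_differentiable f \<longleftrightarrow>
     (\<exists>f' :: 'a \<Rightarrow> 'a \<Rightarrow>\<^sub>L 'b.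
        (\<forall>x. (f has_derivative blinfun_apply (f' x)) (at x)) \<and> continuous_on UNIV f')"

definition gradient :: "('a::real_inner \<Rightarrow> real) \<Rightarrow> 'a \<Rightarrow> 'a" where
  "gradient f x = (THE g. GDERIV f x :> g)"

lemma gradient_eqI:
  assumes "GDERIV f x :> g"
  shows "gradient f x = g"
  unfolding gradient_def
proof (rule the_equality)
  fix h assume "GDERIV f x :> h"
  then have "(\<lambda>v. v \<bullet> h) = (\<lambda>v. v \<bullet> g)"
    using assms unfolding gderiv_def by (rule has_derivative_unique)
  then have "\<forall>v. v \<bullet> h = v \<bullet> g"
    by (simp add: fun_eq_iff)
  then show "h = g"
    by (simp add: vector_eq_ldot)
qed (fact assms)

text \<open>The map \<open>\<psi>(z, w) = (\<nabla>\<^sub>x \<phi>(z, w), - \<nabla>\<^sub>y \<phi>(z, w))\<close> with \<open>z = (x, y)\<close>. The norm of the product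
  type is the Euclidean one.\<close>

definition saddle_gradient ::
    "('a::real_inner \<Rightarrow> 'b::real_inner \<Rightarrow> 'w \<Rightarrow> real) \<Rightarrow> 'a \<times> 'b \<Rightarrow> 'w \<Rightarrow> 'a \<times> 'b" where
  "saddle_gradient \<phi> z w =
     (gradient (\<lambda>x. \<phi> x (snd z) w) (fst z), - gradient (\<lambda>y. \<phi> (fst z) y w) (snd z))"

definition radon_prob_first_moment :: "'w::metric_space measure set" where
  "radon_prob_first_moment =
     {\<mu>. prob_space \<mu> \<and> sets \<mu> = sets borel \<and>
         (\<forall>B\<in>sets borel. emeasure \<mu> B = (SUP K\<in>{K. compact K \<and> K \<subseteq> B}. emeasure \<mu> K)) \<and>
         (\<exists>w\<^sub>0. integrable \<mu> (\<lambda>w. dist w w\<^sub>0))}"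

definition couplings :: "'a measure \<Rightarrow> 'b measure \<Rightarrow> ('a \<times> 'b) measure set" where
  "couplings \<mu> \<nu> =
     {\<pi>. sets \<pi> = sets (\<mu> \<Otimes>\<^sub>M \<nu>) \<and> distr \<pi> \<mu> fst = \<mu> \<and> distr \<pi> \<nu> snd = \<nu>}"

definition wasserstein1 :: "'w::metric_space measure \<Rightarrow> 'w measure \<Rightarrow> ennreal" where
  "wasserstein1 \<mu> \<nu> = (INF \<pi>\<in>couplings \<mu> \<nu>. \<integral>\<^sup>+ (u, v). ennreal (dist u v) \<partial>\<pi>)"

text \<open>The mixture \<open>\<tau> \<mu> + (1 - \<tau>) \<nu>\<close> of two measures on the same measurable space,
  for \<open>\<tau> \<in> [0, 1]\<close>.\<close>

definition mixture :: "real \<Rightarrow> 'w measure \<Rightarrow> 'w measure \<Rightarrow> 'w measure" where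
  "mixture \<tau> \<mu> \<nu> = measure_of (space \<mu>) (sets \<mu>)
     (\<lambda>A. ennreal \<tau> * emeasure \<mu> A + ennreal (1 - \<tau>) * emeasure \<nu> A)"

lemma emeasure_mixture:
  assumes "sets \<nu> = sets \<mu>" and "A \<in> sets \<mu>"
  shows "emeasure (mixture \<tau> \<mu> \<nu>) A
    = ennreal \<tau> * emeasure \<mu> A + ennreal (1 - \<tau>) * emeasure \<nu> A"
proof (rule emeasure_measure_of[OF mixture_def])
  show "sets \<mu> \<subseteq> Pow (space \<mu>)"
    by (rule sets.space_closed)
  show "A \<in> sets (mixture \<tau> \<mu> \<nu>)"
    using assms by (simp add: mixture_def)
  let ?f = "\<lambda>A. ennreal \<tau> * emeasure \<mu> A + ennreal (1 - \<tau>) * emeasure \<nu> A"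
  show "positive (sets (mixture \<tau> \<mu> \<nu>)) ?f"
    by (simp add: positive_def)
  show "countably_additive (sets (mixture \<tau> \<mu> \<nu>)) ?f"
  proof (rule countably_additiveI)
    fix F :: "nat \<Rightarrow> 'a set"
    assume F: "range F \<subseteq> sets (mixture \<tau> \<mu> \<nu>)" "disjoint_family F"
    then have *: "range F \<subseteq> sets \<mu>" "range F \<subseteq> sets \<nu>"
      using assms(1) by (simp_all add: mixture_def)
    show "(\<Sum>i. ?f (F i)) = ?f (\<Union>i. F i)"
      using suminf_emeasure[OF *(1) F(2)] suminf_emeasure[OF *(2) F(2)]
      by (simp add: suminf_add[symmetric])
  qed
qed

definition expected_objective ::
    "('a \<Rightarrow> 'b \<Rightarrow> 'w \<Rightarrow> real) \<Rightarrow> ('a \<Rightarrow> 'b \<Rightarrow> 'w measure) \<Rightarrow> 'a \<Rightarrow> 'b \<Rightarrow> real" where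
  "expected_objective \<phi> D x y = (\<integral>w. \<phi> x y w \<partial>(D x y))"

definition opposing_mixture_dominance ::
    "('a::real_vector \<Rightarrow> 'b::real_vector \<Rightarrow> 'w \<Rightarrow> real) \<Rightarrow> ('a \<Rightarrow> 'b \<Rightarrow> 'w measure) \<Rightarrow> bool" where
  "opposing_mixture_dominance \<phi> D \<longleftrightarrow>
     (\<forall>x x' x\<^sub>0 y y' y\<^sub>0. \<forall>\<tau>\<in>{0..1}.
        (\<integral>w. \<phi> x\<^sub>0 y\<^sub>0 w \<partial>(D (\<tau> *\<^sub>R x + (1 - \<tau>) *\<^sub>R x') y))
          \<le> (\<integral>w. \<phi> x\<^sub>0 y\<^sub>0 w \<partial>(mixture \<tau> (D x y) (D x' y))) \<and>
        (\<integral>w. \<phi> x\<^sub>0 y\<^sub>0 w \<partial>(mixture \<tau> (D x y) (D x y')))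
          \<le> (\<integral>w. \<phi> x\<^sub>0 y\<^sub>0 w \<partial>(D x (\<tau> *\<^sub>R y + (1 - \<tau>) *\<^sub>R y'))))"

definition strongly_convex_strongly_concave ::
    "real \<Rightarrow> ('a::real_normed_vector \<Rightarrow> 'b::real_normed_vector \<Rightarrow> real) \<Rightarrow> bool" where
  "strongly_convex_strongly_concave c f \<longleftrightarrow>
     (\<forall>y. strongly_convex c (\<lambda>x. f x y)) \<and> (\<forall>x. strongly_concave c (\<lambda>y. f x y))"

end

theory Submission
  imports Defs
begin

text \<open>Only one variable moves at a time, so the theorem reduces to an integrand \<open>f u w\<close> that is
  \<open>\<gamma>\<close>-strongly convex in \<open>u\<close>, a family of laws \<open>\<mu> x\<close> of the parameter \<open>w\<close>, and the diagonal
  \<open>F x x\<close> of \<open>F u x = \<integral>w. f u w \<partial>\<mu> x\<close>. At \<open>z = t x + (1 - t) x'\<close>, mixture dominance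
  splits the law and strong convexity splits the integrand:

  \<open>F z z \<le> t F z x + (1 - t) F z x'
    \<le> t F x x + (1 - t) F x' x' - t (1 - t) (\<gamma> / 2 \<parallel>x - x'\<parallel>\<^sup>2 + R)\<close>,

  where the remainder

  \<open>R = F x x + F x' x' - F x x' - F x' x
    = (\<integral>w. f x w - f x' w \<partial>\<mu> x) - (\<integral>w. f x w - f x' w \<partial>\<mu> x')\<close>

  compares the integrals of one function \<open>w \<mapsto> f x w - f x' w\<close> under two laws at distance at
  most \<open>\<epsilon> \<parallel>x - x'\<parallel>\<close>. That function is Lipschitz with constant \<open>L \<parallel>x - x'\<parallel>\<close>, by the mean value
  inequality for \<open>u \<mapsto> f u w - f u w'\<close>, whose gradient is bounded by \<open>L dist w w'\<close>
  (\<open>gradient_diff_le_imp_lipschitz\<close>). Hence \<open>\<bar>R\<bar> \<le> \<epsilon> L \<parallel>x - x'\<parallel>\<^sup>2\<close> by the easy half of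
  Kantorovich--Rubinstein duality (\<open>lipschitz_integral_diff_le_wasserstein1\<close>), which lowers the
  modulus from \<open>\<gamma>\<close> to \<open>\<gamma> - 2 \<epsilon> L\<close>. This is \<open>strongly_convex_diagonal_expectation\<close>; it is applied
  to \<open>\<phi>\<close> in the first variable and to \<open>- \<phi>\<close> in the second.\<close>

section \<open>Strong convexity in an inner product space\<close>

text \<open>The two forms agree because
  \<open>t \<parallel>x\<parallel>\<^sup>2 + (1 - t) \<parallel>y\<parallel>\<^sup>2 - \<parallel>t x + (1 - t) y\<parallel>\<^sup>2 = t (1 - t) \<parallel>x - y\<parallel>\<^sup>2\<close> in an inner product
  space.\<close>

lemma strongly_convex_iff_ineq:
  fixes f :: "'a::real_inner \<Rightarrow> real"
  shows "strongly_convex c f \<longleftrightarrow>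
    (\<forall>x y. \<forall>t\<in>{0..1}. f (t *\<^sub>R x + (1 - t) *\<^sub>R y)
       \<le> t * f x + (1 - t) * f y - c / 2 * (t * (1 - t)) * (norm (x - y))\<^sup>2)"
proof -
  have norm_id: "(norm (t *\<^sub>R x + (1 - t) *\<^sub>R y))\<^sup>2
      = t * (norm x)\<^sup>2 + (1 - t) * (norm y)\<^sup>2 - t * (1 - t) * (norm (x - y))\<^sup>2" for t and x y :: 'a
    by (simp add: power2_norm_eq_inner inner_add inner_diff inner_commute algebra_simps)
  have ineq_iff: "f (t *\<^sub>R x + (1 - t) *\<^sub>R y) - c / 2 * (norm (t *\<^sub>R x + (1 - t) *\<^sub>R y))\<^sup>2
        \<le> t * (f x - c / 2 * (norm x)\<^sup>2) + (1 - t) * (f y - c / 2 * (norm y)\<^sup>2)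
      \<longleftrightarrow> f (t *\<^sub>R x + (1 - t) *\<^sub>R y)
        \<le> t * f x + (1 - t) * f y - c / 2 * (t * (1 - t)) * (norm (x - y))\<^sup>2" for t x y
  proof -
    have "t * (f x - c / 2 * (norm x)\<^sup>2) + (1 - t) * (f y - c / 2 * (norm y)\<^sup>2)
          + c / 2 * (norm (t *\<^sub>R x + (1 - t) *\<^sub>R y))\<^sup>2
        = t * f x + (1 - t) * f y - c / 2 * (t * (1 - t)) * (norm (x - y))\<^sup>2"
      unfolding norm_id by (simp add: field_simps)
    then show ?thesis by linarith
  qed
  have "convex_on UNIV g \<longleftrightarrow> (\<forall>x y. \<forall>t\<in>{0..1}.
      g (t *\<^sub>R x + (1 - t) *\<^sub>R y) \<le> t * g x + (1 - t) * g y)" for g :: "'a \<Rightarrow> real"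
  proof
    assume "convex_on UNIV g"
    then show "\<forall>x y. \<forall>t\<in>{0..1}. g (t *\<^sub>R x + (1 - t) *\<^sub>R y) \<le> t * g x + (1 - t) * g y"
      by (simp add: convex_on_def)
  next
    assume g: "\<forall>x y. \<forall>t\<in>{0..1}. g (t *\<^sub>R x + (1 - t) *\<^sub>R y) \<le> t * g x + (1 - t) * g y"
    show "convex_on UNIV g"
      unfolding convex_on_def
    proof (intro conjI ballI allI impI)
      fix x y u v assume "0 \<le> u" "0 \<le> v" "u + v = (1::real)"
      then have "v = 1 - u" "u \<in> {0..1}" by auto
      then show "g (u *\<^sub>R x + v *\<^sub>R y) \<le> u * g x + v * g y"
        using g by simp
    qed simp
  qed
  then show ?thesis
    unfolding strongly_convex_def by (simp only: ineq_iff)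
qed

section \<open>Gradients and the mean value inequality\<close>

text \<open>A linear functional on a Euclidean space is the inner product with the image of \<open>1\<close> under its
  adjoint, so a derivative is always represented by a gradient.\<close>

lemma gderiv_gradient:
  fixes f :: "'a::euclidean_space \<Rightarrow> real"
  assumes "f differentiable at x"
  shows "GDERIV f x :> gradient f x"
proof -
  obtain f' where f': "(f has_derivative f') (at x)"
    using assms by (auto simp: differentiable_def)
  have "f' = (\<lambda>v. v \<bullet> adjoint f' 1)"
    using adjoint_works[OF has_derivative_linear[OF f'], of _ 1] by simp
  then have "GDERIV f x :> adjoint f' 1"
    using f' unfolding gderiv_def by metis
  then show ?thesis
    using gradient_eqI by metis
qed

text \<open>The mean value inequality for \<open>f - g\<close>. With \<open>f\<close> and \<open>g\<close> the integrand at two parameters, it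
  turns a Lipschitz gradient in the parameter into a Lipschitz increment.\<close>

lemma gradient_diff_le_imp_lipschitz:
  fixes f g :: "'a::euclidean_space \<Rightarrow> real"
  assumes f: "\<And>u. f differentiable at u" and g: "\<And>u. g differentiable at u"
    and le: "\<And>u. norm (gradient f u - gradient g u) \<le> K"
  shows "\<bar>(f x - f x') - (g x - g x')\<bar> \<le> K * norm (x - x')"
proof -
  have "norm ((f x - g x) - (f x' - g x')) \<le> K * norm (x - x')"
  proof (rule differentiable_bound[where S = UNIV])
    fix u :: 'a
    show "((\<lambda>u. f u - g u) has_derivative (\<lambda>v. v \<bullet> (gradient f u - gradient g u))) (at u within UNIV)"
      using GDERIV_diff[OF gderiv_gradient[OF f] gderiv_gradient[OF g]]
      by (simp add: gderiv_def)
    show "onorm (\<lambda>v. v \<bullet> (gradient f u - gradient g u)) \<le> K"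
    proof (rule onorm_bound)
      show "0 \<le> K" using norm_ge_zero le by (rule order_trans)
      show "norm (v \<bullet> (gradient f u - gradient g u)) \<le> K * norm v" for v
      proof -
        have "norm (v \<bullet> (gradient f u - gradient g u)) \<le> norm v * norm (gradient f u - gradient g u)"
          by (simp add: Cauchy_Schwarz_ineq2)
        also have "\<dots> \<le> norm v * K" by (simp add: le mult_left_mono)
        finally show ?thesis by (simp add: mult.commute)
      qed
    qed
  qed simp_all
  then show ?thesis by (simp add: algebra_simps)
qed

lemma continuously_differentiable_imp_differentiable_sections:
  assumes "continuously_differentiable (\<lambda>(x, y). f x y)"
  shows "(\<lambda>x. f x y) differentiable at x" and "(\<lambda>y. f x y) differentiable at y"
proof -
  have diff: "(\<lambda>(x, y). f x y) differentiable at z" for z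
    using assms unfolding continuously_differentiable_def differentiable_def by blast
  have "(\<lambda>x. (x, y)) differentiable at x" "Pair x differentiable at y"
    by (auto simp: differentiable_def intro!: exI derivative_eq_intros)
  then show "(\<lambda>x. f x y) differentiable at x" "(\<lambda>y. f x y) differentiable at y"
    using differentiable_chain_at[of "\<lambda>x. (x, y)" x "\<lambda>(x, y). f x y"]
      differentiable_chain_at[of "Pair x" y "\<lambda>(x, y). f x y"] diff
    by (simp_all add: o_def)
qed

section \<open>Integration against a mixture\<close>

lemma sets_mixture [simp]: "sets (mixture t \<mu> \<nu>) = sets \<mu>"
  by (simp add: mixture_def)

lemma nn_integral_mixture:
  assumes s: "sets \<nu> = sets \<mu>" and f: "f \<in> borel_measurable \<mu>"
  shows "(\<integral>\<^sup>+w. f w \<partial>mixture t \<mu> \<nu>)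
    = ennreal t * (\<integral>\<^sup>+w. f w \<partial>\<mu>) + ennreal (1 - t) * (\<integral>\<^sup>+w. f w \<partial>\<nu>)"
  using f
proof (induction rule: borel_measurable_induct)
  note meas = measurable_cong_sets[OF s refl] measurable_cong_sets[OF sets_mixture refl]
  {
    case (cong f g)
    have "nn_integral M f = nn_integral M g" if "sets M = sets \<mu>" for M
      using cong(3) sets_eq_imp_space_eq[OF that] by (intro nn_integral_cong) simp
    then show ?case using cong(4) s by simp
  next
    case (set A)
    then show ?case by (simp add: s emeasure_mixture)
  next
    case (mult u c)
    then show ?case by (simp add: nn_integral_cmult meas algebra_simps)
  next
    case (add u v)
    then show ?case by (simp add: nn_integral_add meas algebra_simps)
  next
    case (seq U)
    have sup: "nn_integral M (SUP i. U i) = (SUP i. \<integral>\<^sup>+w. U i w \<partial>M)" if "sets M = sets \<mu>" for M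
    proof -
      have "(SUP i. U i) = (\<lambda>w. SUP i. U i w)"
        by (simp add: fun_eq_iff image_comp)
      moreover have "U i \<in> borel_measurable M" for i
        using seq(1) by (simp add: measurable_cong_sets[OF that refl])
      ultimately show ?thesis
        using nn_integral_monotone_convergence_SUP[of U M] seq(3) by metis
    qed
    have inc: "incseq (\<lambda>i. \<integral>\<^sup>+w. U i w \<partial>M)" for M
      using seq(3) by (auto simp: incseq_def le_fun_def intro!: nn_integral_mono)
    show ?case
      unfolding sup[OF sets_mixture] sup[OF refl] sup[OF s] seq(5)
      using inc by (simp add: SUP_mult_left_ennreal ennreal_SUP_add incseq_def mult_left_mono)
  }
qed

lemma integral_mixture:
  fixes f :: "'w \<Rightarrow> real"
  assumes s: "sets \<nu> = sets \<mu>" and f: "integrable \<mu> f" "integrable \<nu> f" and t: "t \<in> {0..1}"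
  shows "(\<integral>w. f w \<partial>mixture t \<mu> \<nu>) = t * (\<integral>w. f w \<partial>\<mu>) + (1 - t) * (\<integral>w. f w \<partial>\<nu>)"
proof -
  \<comment> \<open>\<open>part\<close> is used for \<open>f\<close> and for \<open>- f\<close>, since \<open>ennreal\<close> sends negative values to \<open>0\<close>.\<close>
  have part: "(\<integral>\<^sup>+w. ennreal (h w) \<partial>mixture t \<mu> \<nu>) < \<infinity> \<and>
      enn2real (\<integral>\<^sup>+w. ennreal (h w) \<partial>mixture t \<mu> \<nu>)
        = t * enn2real (\<integral>\<^sup>+w. ennreal (h w) \<partial>\<mu>) + (1 - t) * enn2real (\<integral>\<^sup>+w. ennreal (h w) \<partial>\<nu>)"
    if h: "integrable \<mu> h" "integrable \<nu> h" for h :: "'w \<Rightarrow> real"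
  proof -
    have fin: "(\<integral>\<^sup>+w. ennreal (h w) \<partial>\<mu>) < \<infinity>" "(\<integral>\<^sup>+w. ennreal (h w) \<partial>\<nu>) < \<infinity>"
      using h by (simp_all add: real_integrable_def top.not_eq_extremum)
    have "(\<lambda>w. ennreal (h w)) \<in> borel_measurable \<mu>"
      using h(1) by simp
    then show ?thesis
      using fin t by (simp add: nn_integral_mixture[OF s] enn2real_plus enn2real_mult
          ennreal_mult_less_top)
  qed
  have neg: "integrable \<mu> (\<lambda>w. - f w)" "integrable \<nu> (\<lambda>w. - f w)"
    using f by simp_all
  have "f \<in> borel_measurable (mixture t \<mu> \<nu>)"
    using f(1) by (simp add: measurable_cong_sets[OF sets_mixture refl] borel_measurable_integrable)
  then have "integrable (mixture t \<mu> \<nu>) f"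
    using part[OF f] part[OF neg] by (simp add: real_integrable_def top.not_eq_extremum)
  then show ?thesis
    using part[OF f] part[OF neg] f by (simp add: real_lebesgue_integral_def algebra_simps)
qed

section \<open>The easy half of Kantorovich--Rubinstein duality\<close>

text \<open>Both integrals can be computed under any coupling \<open>\<pi>\<close> of the two laws, where their
  difference is the integral of \<open>g u - g v\<close>.\<close>

lemma lipschitz_integral_diff_le_coupling_cost:
  fixes g :: "'w::polish_space \<Rightarrow> real"
  assumes b: "sets \<mu> = sets borel" "sets \<nu> = sets borel"
    and \<pi>: "\<pi> \<in> couplings \<mu> \<nu>"
    and g: "integrable \<mu> g" "integrable \<nu> g"
    and lip: "\<And>u v. \<bar>g u - g v\<bar> \<le> K * dist u v" and K: "0 \<le> K"
  shows "ennreal \<bar>(\<integral>w. g w \<partial>\<mu>) - (\<integral>w. g w \<partial>\<nu>)\<bar>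
    \<le> ennreal K * (\<integral>\<^sup>+(u, v). ennreal (dist u v) \<partial>\<pi>)"
proof -
  have sets_\<pi>: "sets \<pi> = sets (\<mu> \<Otimes>\<^sub>M \<nu>)" and marg: "distr \<pi> \<mu> fst = \<mu>" "distr \<pi> \<nu> snd = \<nu>"
    using \<pi> by (auto simp: couplings_def)
  have proj [measurable]: "fst \<in> measurable \<pi> \<mu>" "snd \<in> measurable \<pi> \<nu>"
    by (simp_all add: measurable_cong_sets[OF sets_\<pi> refl])
  have [measurable]: "fst \<in> borel_measurable \<pi>" "snd \<in> borel_measurable \<pi>"
    using proj b by (simp_all cong: measurable_cong_sets)
  have int: "integrable \<pi> (\<lambda>z. g (fst z))" "integrable \<pi> (\<lambda>z. g (snd z))"
    using g by (simp_all add: marg flip: integrable_distr_eq[OF proj(1)] integrable_distr_eq[OF proj(2)])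
  have "(\<integral>w. g w \<partial>\<mu>) = (\<integral>z. g (fst z) \<partial>\<pi>)" "(\<integral>w. g w \<partial>\<nu>) = (\<integral>z. g (snd z) \<partial>\<pi>)"
    using integral_distr[OF proj(1), of g] integral_distr[OF proj(2), of g] g
    by (simp_all add: marg)
  then have "ennreal \<bar>(\<integral>w. g w \<partial>\<mu>) - (\<integral>w. g w \<partial>\<nu>)\<bar> = ennreal (norm (\<integral>z. g (fst z) - g (snd z) \<partial>\<pi>))"
    using int by simp
  also have "\<dots> \<le> (\<integral>\<^sup>+z. ennreal (norm (g (fst z) - g (snd z))) \<partial>\<pi>)"
    using int by (intro integral_norm_bound_ennreal) simp
  also have "\<dots> \<le> (\<integral>\<^sup>+z. ennreal K * ennreal (dist (fst z) (snd z)) \<partial>\<pi>)"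
    using lip K by (intro nn_integral_mono) (simp flip: ennreal_mult)
  also have "\<dots> = ennreal K * (\<integral>\<^sup>+z. ennreal (dist (fst z) (snd z)) \<partial>\<pi>)"
    by (rule nn_integral_cmult) measurable
  finally show ?thesis by (simp add: case_prod_unfold)
qed

lemma lipschitz_integral_diff_le_wasserstein1:
  fixes g :: "'w::polish_space \<Rightarrow> real"
  assumes "sets \<mu> = sets borel" "sets \<nu> = sets borel"
    and "integrable \<mu> g" "integrable \<nu> g"
    and "\<And>u v. \<bar>g u - g v\<bar> \<le> K * dist u v" and K: "0 \<le> K"
    and W: "wasserstein1 \<mu> \<nu> \<le> ennreal e" and e: "0 \<le> e"
  shows "\<bar>(\<integral>w. g w \<partial>\<mu>) - (\<integral>w. g w \<partial>\<nu>)\<bar> \<le> K * e"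
proof -
  \<comment> \<open>An optimal coupling need not exist, so the slack \<open>d\<close> makes room for a nearly optimal one.\<close>
  have approx: "\<bar>(\<integral>w. g w \<partial>\<mu>) - (\<integral>w. g w \<partial>\<nu>)\<bar> \<le> K * (e + d)" if "0 < d" for d
  proof -
    have "wasserstein1 \<mu> \<nu> < ennreal (e + d)"
      using W e that by (auto intro: le_less_trans simp: ennreal_less_iff)
    then obtain \<pi> where \<pi>: "\<pi> \<in> couplings \<mu> \<nu>"
      and cost: "(\<integral>\<^sup>+(u, v). ennreal (dist u v) \<partial>\<pi>) < ennreal (e + d)"
      unfolding wasserstein1_def by (auto simp: INF_less_iff)
    have "ennreal \<bar>(\<integral>w. g w \<partial>\<mu>) - (\<integral>w. g w \<partial>\<nu>)\<bar>
        \<le> ennreal K * (\<integral>\<^sup>+(u, v). ennreal (dist u v) \<partial>\<pi>)"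
      by (rule lipschitz_integral_diff_le_coupling_cost[OF assms(1,2) \<pi> assms(3-6)])
    also have "\<dots> \<le> ennreal K * ennreal (e + d)"
      using cost by (intro mult_left_mono) auto
    finally show ?thesis
      using K e that by (simp del: ennreal_plus flip: ennreal_mult)
  qed
  have "((\<lambda>d. K * (e + d)) \<longlongrightarrow> K * (e + 0)) (at_right 0)"
    by (intro tendsto_intros)
  then have "\<bar>(\<integral>w. g w \<partial>\<mu>) - (\<integral>w. g w \<partial>\<nu>)\<bar> \<le> K * (e + 0)"
    by (rule tendsto_lowerbound) (use approx in \<open>auto simp: eventually_at_filter\<close>)
  then show ?thesis by simp
qed

section \<open>Strong convexity of the expected objective\<close>

text \<open>The one-variable form of the theorem. Strong concavity is the same assertion for \<open>- f\<close>, for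
  which the dominance hypothesis on the second variable takes the form used here.\<close>

lemma strongly_convex_diagonal_expectation:
  fixes f :: "'a::real_inner \<Rightarrow> 'w::polish_space \<Rightarrow> real" and \<mu> :: "'a \<Rightarrow> 'w measure"
  assumes "0 \<le> L" "0 \<le> \<epsilon>"
    and prob: "\<And>x. prob_space (\<mu> x)" and borel: "\<And>x. sets (\<mu> x) = sets borel"
    and int: "\<And>x u. integrable (\<mu> x) (f u)"
    and sc: "\<And>w. strongly_convex \<gamma> (\<lambda>u. f u w)"
    and lip: "\<And>x x' w w'. \<bar>(f x w - f x' w) - (f x w' - f x' w')\<bar> \<le> L * dist w w' * norm (x - x')"
    and W: "\<And>x x'. wasserstein1 (\<mu> x) (\<mu> x') \<le> ennreal (\<epsilon> * norm (x - x'))"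
    and dom: "\<And>x x' u t. t \<in> {0..1} \<Longrightarrow>
      (\<integral>w. f u w \<partial>\<mu> (t *\<^sub>R x + (1 - t) *\<^sub>R x')) \<le> (\<integral>w. f u w \<partial>mixture t (\<mu> x) (\<mu> x'))"
  shows "strongly_convex (\<gamma> - 2 * \<epsilon> * L) (\<lambda>x. \<integral>w. f x w \<partial>\<mu> x)"
  unfolding strongly_convex_iff_ineq
proof (intro allI ballI)
  fix x x' :: 'a and t :: real
  assume t: "t \<in> {0..1}"
  define F where "F = (\<lambda>u v. \<integral>w. f u w \<partial>\<mu> v)"
  let ?xt = "t *\<^sub>R x + (1 - t) *\<^sub>R x'"
  let ?N = "(norm (x - x'))\<^sup>2"
  have "F ?xt ?xt \<le> t * F ?xt x + (1 - t) * F ?xt x'"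
    using dom[OF t, where x = x and x' = x' and u = ?xt] integral_mixture[OF _ int int t, of x' x ?xt] borel
    by (simp add: F_def)
  moreover have split: "F ?xt v \<le> t * F x v + (1 - t) * F x' v - \<gamma> / 2 * (t * (1 - t)) * ?N" for v
  proof -
    interpret prob_space "\<mu> v" by (rule prob)
    have "F ?xt v \<le> (\<integral>w. t * f x w + (1 - t) * f x' w - \<gamma> / 2 * (t * (1 - t)) * ?N \<partial>\<mu> v)"
      unfolding F_def using sc t int
      by (intro integral_mono) (auto simp: strongly_convex_iff_ineq)
    also have "\<dots> = t * F x v + (1 - t) * F x' v - \<gamma> / 2 * (t * (1 - t)) * ?N"
      using int by (simp add: F_def prob_space)
    finally show ?thesis .
  qed
  moreover have "t * F ?xt x + (1 - t) * F ?xt x'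
      \<le> t * (t * F x x + (1 - t) * F x' x - \<gamma> / 2 * (t * (1 - t)) * ?N)
        + (1 - t) * (t * F x x' + (1 - t) * F x' x' - \<gamma> / 2 * (t * (1 - t)) * ?N)"
    using t split by (intro add_mono mult_left_mono) auto
  \<comment> \<open>The weights of the cross terms \<open>F x x'\<close> and \<open>F x' x\<close> are both \<open>t (1 - t)\<close>, and replacing
    those terms by \<open>F x x\<close> and \<open>F x' x'\<close> leaves this double difference as the error.\<close>
  moreover have "\<bar>(F x x - F x' x) - (F x x' - F x' x')\<bar> \<le> \<epsilon> * L * ?N"
  proof -
    have "\<bar>(\<integral>w. f x w - f x' w \<partial>\<mu> x) - (\<integral>w. f x w - f x' w \<partial>\<mu> x')\<bar>
        \<le> (L * norm (x - x')) * (\<epsilon> * norm (x - x'))"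
      using lip[of x _ x'] W assms(1,2) int borel
      by (intro lipschitz_integral_diff_le_wasserstein1) (auto simp: ac_simps)
    then show ?thesis
      using int by (simp add: F_def power2_eq_square ac_simps)
  qed
  then have "t * (1 - t) * ((F x x' - F x' x') - (F x x - F x' x)) \<le> t * (1 - t) * (\<epsilon> * L * ?N)"
    using t by (intro mult_left_mono) auto
  ultimately have "F ?xt ?xt \<le> t * F x x + (1 - t) * F x' x'
      - (\<gamma> - 2 * \<epsilon> * L) / 2 * (t * (1 - t)) * ?N"
    by (simp add: field_simps)
  then show "(\<integral>w. f ?xt w \<partial>\<mu> ?xt) \<le> t * (\<integral>w. f x w \<partial>\<mu> x) + (1 - t) * (\<integral>w. f x' w \<partial>\<mu> x')
      - (\<gamma> - 2 * \<epsilon> * L) / 2 * (t * (1 - t)) * ?N"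
    by (simp add: F_def)
qed

theorem theorem3p2:
  fixes \<gamma> L \<epsilon> :: real
    and \<phi> :: "real ^ 'n \<Rightarrow> real ^ 'm \<Rightarrow> 'w::polish_space \<Rightarrow> real"
    and D :: "real ^ 'n \<Rightarrow> real ^ 'm \<Rightarrow> 'w measure"
  assumes "\<gamma> > 0" and "L > 0" and "\<epsilon> \<ge> 0"
    and "\<And>x y. D x y \<in> radon_prob_first_moment"
    and "\<And>x y x\<^sub>0 y\<^sub>0. integrable (D x y) (\<phi> x\<^sub>0 y\<^sub>0)"
    and "\<And>w. continuously_differentiable (\<lambda>(x, y). \<phi> x y w)"
    and "\<And>w. strongly_convex_strongly_concave \<gamma> (\<lambda>x y. \<phi> x y w)"
    and "\<And>z z' w.
          norm (saddle_gradient \<phi> z w - saddle_gradient \<phi> z' w) \<le> L * norm (z - z')"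
    and "\<And>z w w'.
          norm (saddle_gradient \<phi> z w - saddle_gradient \<phi> z w') \<le> L * dist w w'"
    and "\<And>x y x' y'.
          wasserstein1 (D x y) (D x' y') \<le> ennreal (\<epsilon> * norm ((x, y) - (x', y')))"
    and "opposing_mixture_dominance \<phi> D"
  shows "strongly_convex_strongly_concave (\<gamma> - 2 * \<epsilon> * L) (expected_objective \<phi> D)"
proof -
  note pos = less_imp_le[OF assms(2)] assms(3)
  have prob: "prob_space (D x y)" and borel: "sets (D x y) = sets borel" for x y
    using assms(4)[of x y] by (auto simp: radon_prob_first_moment_def)
  note diff = continuously_differentiable_imp_differentiable_sections[OF assms(6)]
  have fst_snd: "norm (fst p) \<le> norm p" "norm (snd p) \<le> norm p"
    for p :: "(real ^ 'n) \<times> (real ^ 'm)"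
    using norm_fst_le[of "fst p" "snd p"] norm_snd_le[of "snd p" "fst p"] by simp_all
  have "norm (gradient (\<lambda>x. \<phi> x y w) x - gradient (\<lambda>x. \<phi> x y w') x) \<le> L * dist w w'"
    and "norm (gradient (\<lambda>y. \<phi> x y w) y - gradient (\<lambda>y. \<phi> x y w') y) \<le> L * dist w w'" for x y w w'
    using order_trans[OF fst_snd(1) assms(9)[of "(x, y)" w w']]
      order_trans[OF fst_snd(2) assms(9)[of "(x, y)" w w']]
    by (simp_all add: saddle_gradient_def norm_minus_commute)
  then have lip_x: "\<bar>(\<phi> x y w - \<phi> x' y w) - (\<phi> x y w' - \<phi> x' y w')\<bar> \<le> L * dist w w' * norm (x - x')"
    and lip_y: "\<bar>(\<phi> x y w - \<phi> x y' w) - (\<phi> x y w' - \<phi> x y' w')\<bar> \<le> L * dist w w' * norm (y - y')"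
    for x x' y y' w w'
    by (intro gradient_diff_le_imp_lipschitz diff; simp)+
  have "strongly_convex (\<gamma> - 2 * \<epsilon> * L) (\<lambda>x. \<integral>w. \<phi> x y w \<partial>D x y)" for y
  proof (rule strongly_convex_diagonal_expectation[OF pos])
    show "wasserstein1 (D x y) (D x' y) \<le> ennreal (\<epsilon> * norm (x - x'))" for x x'
      using assms(10)[of x y x' y] by (simp add: norm_Pair)
    show "(\<integral>w. \<phi> u y w \<partial>D (t *\<^sub>R x + (1 - t) *\<^sub>R x') y)
        \<le> (\<integral>w. \<phi> u y w \<partial>mixture t (D x y) (D x' y))" if "t \<in> {0..1}" for x x' u t
      using assms(11) that by (auto simp: opposing_mixture_dominance_def)
  qed (use prob borel assms(5,7) lip_x in \<open>auto simp: strongly_convex_strongly_concave_def\<close>)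
  moreover have "strongly_convex (\<gamma> - 2 * \<epsilon> * L) (\<lambda>y. \<integral>w. - \<phi> x y w \<partial>D x y)" for x
  proof (rule strongly_convex_diagonal_expectation[OF pos])
    show "wasserstein1 (D x y) (D x y') \<le> ennreal (\<epsilon> * norm (y - y'))" for y y'
      using assms(10)[of x y x y'] by (simp add: norm_Pair)
    show "(\<integral>w. - \<phi> x u w \<partial>D x (t *\<^sub>R y + (1 - t) *\<^sub>R y'))
        \<le> (\<integral>w. - \<phi> x u w \<partial>mixture t (D x y) (D x y'))" if "t \<in> {0..1}" for y y' u t
      using assms(11) that by (auto simp: opposing_mixture_dominance_def)
    show "\<bar>(- \<phi> x y w - - \<phi> x y' w) - (- \<phi> x y w' - - \<phi> x y' w')\<bar> \<le> L * dist w w' * norm (y - y')"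
      for y y' w w'
      using lip_y[of x y w y' w'] by linarith
  qed (use prob borel assms(5,7) in
      \<open>auto simp: strongly_convex_strongly_concave_def strongly_concave_def\<close>)
  ultimately show ?thesis
    by (simp add: strongly_convex_strongly_concave_def strongly_concave_def
        expected_objective_def)
qed

end
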